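(* If $m$ is an even positive integer, then $$\binom{2m-1}{m-1}\not\equiv 1 \pmod{m^2}.$$ *)

theory Defs
  imports "HOL-Number_Theory.Cong"
begin

end

theory Submission imports Defs begin

text \<open>
  Write \<open>D m\<close> for the binomial coefficient, i.e. half of the central binomial coefficient
  \<open>2m choose m\<close>, and \<open>P n\<close> for the product of the first \<open>n\<close> odd numbers.
  From \<open>(2n)! = 2^n n! P n\<close> one gets \<open>D (2n) (P n)^2 = D n P (2n)\<close>. Modulo 4 an odd square is 1 and
  \<open>P (2n)\<close> is \<open>(-1)^n\<close>, so \<open>D (2n) = (-1)^n D n\<close>. As \<open>D 1 = 1\<close> and \<open>D n\<close> is even for odd \<open>n > 1\<close>,
  induction shows that \<open>D m\<close> is never 1 modulo 4 for even \<open>m\<close>, and 4 divides \<open>m^2\<close>.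
\<close>

lemma fact_double_eq_prod_odd:
  "fact (2 * n) = 2 ^ n * fact n * (\<Prod>i<n. 2 * i + 1 :: nat)"
  by (induction n) (simp_all add: algebra_simps)

lemma central_binomial_times_fact:
  "((2 * n) choose n) * fact n = 2 ^ n * (\<Prod>i<n. 2 * i + 1 :: nat)"
proof -
  have "fact n * fact n * ((2 * n) choose n) = (fact (2 * n) :: nat)"
    using binomial_fact_lemma[of n "2 * n"] by simp
  then have "fact n * (((2 * n) choose n) * fact n) = fact n * (2 ^ n * (\<Prod>i<n. 2 * i + 1 :: nat))"
    unfolding fact_double_eq_prod_odd by (simp only: mult_ac)
  then show ?thesis by simp
qed

text \<open>\<open>central_binomial_times_fact\<close> at \<open>2 * n\<close> brings in
  \<open>fact (2 * n)\<close>, which \<open>fact_double_eq_prod_odd\<close> splits again. After a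
  factor \<open>2 ^ n\<close> cancels, the same lemma at \<open>n\<close> trades the remaining
  \<open>2 ^ n * P n\<close> for a binomial coefficient times \<open>fact n\<close>.\<close>

lemma central_binomial_double:
  "((4 * n) choose (2 * n)) * (\<Prod>i<n. 2 * i + 1 :: nat)\<^sup>2
     = ((2 * n) choose n) * (\<Prod>i<2 * n. 2 * i + 1)"
proof -
  define P where "P k = (\<Prod>i<k. 2 * i + 1 :: nat)" for k
  have "((4 * n) choose (2 * n)) * (2 ^ n * fact n * P n) = 2 ^ (2 * n) * P (2 * n)"
    using central_binomial_times_fact[of "2 * n"]
    unfolding fact_double_eq_prod_odd P_def by simp
  then have "2 ^ n * (((4 * n) choose (2 * n)) * fact n * P n) = 2 ^ n * (2 ^ n * P (2 * n))"
    unfolding mult_2[of n] power_add by (simp only: mult_ac)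
  then have "((4 * n) choose (2 * n)) * fact n * P n = 2 ^ n * P (2 * n)"
    by simp
  then have "((4 * n) choose (2 * n)) * fact n * P n * P n = (2 ^ n * P n) * P (2 * n)"
    by (simp add: mult_ac)
  also have "2 ^ n * P n = ((2 * n) choose n) * fact n"
    using central_binomial_times_fact[of n] by (simp add: P_def)
  finally have "fact n * (((4 * n) choose (2 * n)) * (P n)\<^sup>2)
      = fact n * (((2 * n) choose n) * P (2 * n))"
    by (simp add: power2_eq_square mult_ac)
  then show ?thesis by (simp add: P_def)
qed

lemma central_binomial_eq_twice:
  fixes n :: nat
  assumes "n > 0"
  shows "(2 * n) choose n = 2 * ((2 * n - 1) choose (n - 1))"
  using times_binomial_minus1_eq[OF assms, of "2 * n"] assms by simp

text \<open>The base \<open>3\<close> stands for -1 modulo 4, which keeps the sign inside the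
  natural numbers.\<close>

lemma half_central_binomial_double_cong:
  fixes n :: nat
  assumes "n > 0"
  shows "[(4 * n - 1) choose (2 * n - 1) = ((2 * n - 1) choose (n - 1)) * 3 ^ n] (mod 4)"
proof -
  define P where "P k = (\<Prod>i<k. 2 * i + 1 :: nat)" for k
  define x where "x = (4 * n - 1) choose (2 * n - 1)"
  define y where "y = (2 * n - 1) choose (n - 1)"
  \<comment> \<open>Both central coefficients are twice their halves, so a factor 2 cancels.\<close>
  have eq: "x * (P n)\<^sup>2 = y * P (2 * n)"
    using central_binomial_double[of n] central_binomial_eq_twice[OF assms]
      central_binomial_eq_twice[of "2 * n"] assms
    by (simp add: P_def x_def y_def)
  have "odd (P n)"
    unfolding P_def by (induction n) auto
  then obtain k where "P n = 2 * k + 1"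
    by (rule oddE)
  then have "(P n)\<^sup>2 = 1 + 4 * (k\<^sup>2 + k)"
    by (simp add: power2_eq_square algebra_simps)
  then have sq: "[(P n)\<^sup>2 = 1] (mod 4)"
    by (simp add: cong_def mod_simps)
  \<comment> \<open>The odd numbers below \<open>4 * n\<close> form \<open>n\<close> consecutive
    pairs, each contributing one factor -1 modulo 4.\<close>
  have step: "[(4 * j + 1) * (4 * j + 3) = 3] (mod 4)" for j :: nat
    using cong_mult[of "4 * j + 1" 1 4 "4 * j + 3" 3] by (simp add: cong_def)
  have P3: "[P (2 * n) = 3 ^ n] (mod 4)"
  proof (induction n)
    case (Suc j)
    have "P (2 * Suc j) = P (2 * j) * ((4 * j + 1) * (4 * j + 3))"
      by (simp add: P_def algebra_simps)
    then show ?case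
      using cong_mult[OF Suc step[of j]] by (simp add: mult.commute)
  qed (simp add: P_def)
  have "[x = x * (P n)\<^sup>2] (mod 4)"
    using cong_scalar_left[OF sq, of x] by (simp add: cong_sym)
  then have "[x = y * 3 ^ n] (mod 4)"
    unfolding eq using cong_scalar_left[OF P3, of y] by (rule cong_trans)
  then show ?thesis
    by (simp add: x_def y_def)
qed

text \<open>Absorption turns \<open>n\<close> times the coefficient into \<open>2 * n - 1\<close>
  times the central coefficient for \<open>n - 1\<close>, which is even because
  \<open>n - 1 > 0\<close>. The odd factor \<open>n\<close> leaves parity unchanged.\<close>

lemma even_half_central_binomial:
  fixes n :: nat
  assumes "odd n" "n > 1"
  shows "even ((2 * n - 1) choose (n - 1))"
proof -
  have "n * ((2 * n - 1) choose n) = (2 * n - 1) * ((2 * n - 2) choose (n - 1))"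
    using times_binomial_minus1_eq[of n "2 * n - 1"] assms by (simp add: numeral_2_eq_2)
  moreover have "(2 * n - 1) choose n = (2 * n - 1) choose (n - 1)"
    using binomial_symmetric[of n "2 * n - 1"] assms by simp
  moreover have "even ((2 * n - 2) choose (n - 1))"
    using central_binomial_eq_twice[of "n - 1"] assms by (simp add: diff_mult_distrib2)
  ultimately have "even (n * ((2 * n - 1) choose (n - 1)))"
    by simp
  with assms show ?thesis by simp
qed

lemma half_central_binomial_mod_4:
  fixes m :: nat
  assumes "even m" "m > 0"
  shows "\<not> [(2 * m - 1) choose (m - 1) = 1] (mod 4)"
  using assms
proof (induction m rule: less_induct)
  case (less m)
  then obtain n where m: "m = 2 * n" and n: "n > 0"
    by (auto elim: evenE)
  define y where "y = (2 * n - 1) choose (n - 1)"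
  have c: "[(2 * m - 1) choose (m - 1) = y * 3 ^ n] (mod 4)"
    using half_central_binomial_double_cong[OF n] by (simp add: m y_def)
  have "\<not> [y * 3 ^ n = 1] (mod 4)"
  \<comment> \<open>For even \<open>n\<close> the sign is +1 and the induction hypothesis applies to
    \<open>n < m\<close>; for odd \<open>n > 1\<close> parity decides; for \<open>n = 1\<close> the
    product is 3.\<close>
  proof (cases "even n")
    case True
    then obtain k where "n = 2 * k" by (rule evenE)
    then have "[3 ^ n = (1 :: nat)] (mod 4)"
      using cong_pow[of "9 :: nat" 1 4 k] by (simp add: power_mult cong_def)
    then have "[y * 3 ^ n = y] (mod 4)"
      using cong_scalar_left[of "3 ^ n" 1 4 y] by simp
    moreover have "\<not> [y = 1] (mod 4)"
      using less.IH[of n] True n m by (simp add: y_def)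
    ultimately show ?thesis
      by (simp add: cong_def)
  next
    case False
    show ?thesis
    proof (cases "n = 1")
      case True
      then show ?thesis by (simp add: y_def cong_def)
    next
      case ne: False
      then have "even (y * 3 ^ n)"
        using even_half_central_binomial[of n] False n by (simp add: y_def)
      then show ?thesis
        unfolding cong_def by presburger
    qed
  qed
  then show ?case
    using c by (simp add: cong_def)
qed

theorem theorem6:
  fixes m :: nat
  assumes "even m" and "m > 0"
  shows "\<not> [(2 * m - 1) choose (m - 1) = 1] (mod m\<^sup>2)"
proof
  assume "[(2 * m - 1) choose (m - 1) = 1] (mod m\<^sup>2)"
  moreover have "4 dvd m\<^sup>2"
    using assms(1) by (auto elim!: evenE simp: power_mult_distrib)
  ultimately have "[(2 * m - 1) choose (m - 1) = 1] (mod 4)"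
    by (rule cong_dvd_modulus_nat)
  with half_central_binomial_mod_4[OF assms] show False ..
qed

end
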